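(* Let $a_1,a_2,c_1,c_2\in\mathbb{R}$ satisfy $a_1<a_2$, $c_1<c_2$, $a_1+c_1<0$, $a_2+c_2>0$, and let $p^i(x)=a_ix_1^2+c_ix_2^2$, $i=1,2$, on $\mathbb{R}^2$. Consider the double obstacle problem with obstacles $p^1\le p^2$. Case 1) If $a_2+c_1=c_2+a_1=0$, then there are infinitely many rotationally invariant halfspace solutions corresponding to $p^1$, and likewise infinitely many rotationally invariant halfspace solutions corresponding to $p^2$. Case 2) If $(a_1+c_2)(c_1+a_2)<0$, then there exist infinitely many halfspace solutions corresponding to $p^1$, and likewise infinitely many corresponding to $p^2$; for the halfspace solutions corresponding to $p^i$, the line $\varGamma_i$ always remains inside a fixed cone (depending only on $p^1,p^2$ and $i$), so that the halfspace solutions are not rotationally invariant on the entire plane. Case 3) Suppose $(a_1+c_2)(c_1+a_2)\ge0$, and $a_1+c_2\neq0$ or $a_2+c_1\ne0$. If $a_1+c_2\ge0$ and $a_2+c_1>0$, then there are infinitely many rotationally invariant halfspace solutions corresponding to $p^1$, and at most two halfspace solutions corresponding to $p^2$. If $a_1+c_2\le0$ and $a_2+c_1<0$, then there are infinitely many rotationally invariant halfspace solutions corresponding to $p^2$, and at most two halfspace solutions corresponding to $p^1$.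
   Context: Let $\lambda_i=\Delta p^i$, so $\lambda_1<0<\lambda_2$. A function $u$ on $\mathbb{R}^2$ is a halfspace (halfplane) solution to the double obstacle problem corresponding to $p^1$ if $u\le p^2$ in $\mathbb{R}^2$ and $u-p^1=-\frac{\lambda_1}{2}(x\cdot e)_+^2$ for a unit vector $e$; it is a halfspace solution corresponding to $p^2$ if $u\ge p^1$ in $\mathbb{R}^2$ and $p^2-u=\frac{\lambda_2}{2}(x\cdot e)_+^2$ for a unit vector $e$. For a halfspace solution corresponding to $p^i$, $\varGamma_i=\partial\{u\neq p^i\}$ is the line $\{x\cdot e=0\}$. "Rotationally invariant halfspace solutions corresponding to $p^i$" means that the line $\varGamma_i$ can be any line through the origin; "inside a fixed cone" refers to a cone that is not the whole plane, so not every line through the origin occurs as $\varGamma_i$. *)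

theory Defs
  imports "HOL-Analysis.Analysis"
begin

definition laplacian :: "('a::euclidean_space \<Rightarrow> real) \<Rightarrow> 'a \<Rightarrow> real" where
  "laplacian f x = (\<Sum>b\<in>Basis. deriv (deriv (\<lambda>t::real. f (x + t *\<^sub>R b))) 0)"

text \<open>
  The obstacles are \<open>p1 \<le> p2\<close>. For the quadratic obstacles considered here the Laplacians are
  constant, so evaluating them at the running point \<open>x\<close> gives the constants \<open>\<lambda>\<^sub>1\<close>, \<open>\<lambda>\<^sub>2\<close>.
\<close>

definition halfspace_solutions1 ::
    "(real^2 \<Rightarrow> real) \<Rightarrow> (real^2 \<Rightarrow> real) \<Rightarrow> (real^2 \<Rightarrow> real) set" where
  "halfspace_solutions1 p1 p2 =
    {u. (\<forall>x. u x \<le> p2 x) \<and>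
        (\<exists>e. norm e = 1 \<and> (\<forall>x. u x - p1 x = - (laplacian p1 x / 2) * (max 0 (x \<bullet> e))\<^sup>2))}"

definition halfspace_solutions2 ::
    "(real^2 \<Rightarrow> real) \<Rightarrow> (real^2 \<Rightarrow> real) \<Rightarrow> (real^2 \<Rightarrow> real) set" where
  "halfspace_solutions2 p1 p2 =
    {u. (\<forall>x. p1 x \<le> u x) \<and>
        (\<exists>e. norm e = 1 \<and> (\<forall>x. p2 x - u x = (laplacian p2 x / 2) * (max 0 (x \<bullet> e))\<^sup>2))}"

definition free_boundary :: "(real^2 \<Rightarrow> real) \<Rightarrow> (real^2 \<Rightarrow> real) \<Rightarrow> (real^2) set" where
  "free_boundary p u = frontier {x. u x \<noteq> p x}"

text \<open>
  Rotational invariance is a property of the whole family \<open>S\<close> of solutions corresponding to \<open>p\<close>: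
  every line through the origin occurs as a free boundary.
\<close>

definition rotationally_invariant :: "(real^2 \<Rightarrow> real) \<Rightarrow> (real^2 \<Rightarrow> real) set \<Rightarrow> bool" where
  "rotationally_invariant p S \<longleftrightarrow>
    (\<forall>L. subspace L \<and> dim L = 1 \<longrightarrow> (\<exists>u\<in>S. free_boundary p u = L))"

text \<open>
  Closedness of the cone excludes degenerate choices such as the plane with a single ray removed.
\<close>

definition confined_to_cone :: "(real^2 \<Rightarrow> real) \<Rightarrow> (real^2 \<Rightarrow> real) set \<Rightarrow> bool" where
  "confined_to_cone p S \<longleftrightarrow>
    (\<exists>K. cone K \<and> closed K \<and> K \<noteq> UNIV \<and> (\<forall>u\<in>S. free_boundary p u \<subseteq> K))"

end

theory Submission
  imports Defs
begin

text \<open>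
  With \<open>A = a2 - a1\<close>, \<open>C = c2 - c1\<close> and \<open>l = - laplacian p1 / 2\<close>, the function
  \<open>p1 + l (x \<bullet> e)\<^sub>+\<^sup>2\<close> is a solution iff the half-plane bump stays below \<open>p2 - p1 = A x\<^sub>1\<^sup>2 + C x\<^sub>2\<^sup>2\<close>.
  By the Cauchy--Schwarz inequality for this quadratic form, that means
  \<open>l (e\<^sub>1\<^sup>2 / A + e\<^sub>2\<^sup>2 / C) \<le> 1 = e\<^sub>1\<^sup>2 + e\<^sub>2\<^sup>2\<close>, a homogeneous quadratic inequality in \<open>e\<close> whose
  coefficients have the signs of \<open>A - l = a2 + c1\<close> and \<open>C - l = c2 + a1\<close>. For \<open>p2\<close> the roles of these
  two numbers are interchanged and their signs reversed. The cases of the theorem are the sign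
  patterns of such a diagonal form on the unit circle.
\<close>

section \<open>Solutions parametrized by unit directions\<close>

definition halfspace_perturbation ::
    "('a::real_inner \<Rightarrow> real) \<Rightarrow> real \<Rightarrow> 'a \<Rightarrow> 'a \<Rightarrow> real" where
  "halfspace_perturbation p k e = (\<lambda>x. p x + k * (max 0 (x \<bullet> e))\<^sup>2)"

definition unit_directions :: "real \<Rightarrow> real \<Rightarrow> (real^2) set" where
  "unit_directions m n = {e. norm e = 1 \<and> 0 \<le> m * (e $ 1)\<^sup>2 + n * (e $ 2)\<^sup>2}"

text \<open>Trades a condition on the solution \<open>u\<close> for a condition on its direction
  \<open>e\<close>; this is how both solution sets become images of sets of unit vectors.\<close>

lemma Collect_parametrized_eq_image:
  assumes "\<And>e. N e \<Longrightarrow> P (h e) \<longleftrightarrow> R e"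
  shows "{u. P u \<and> (\<exists>e. N e \<and> u = h e)} = h ` {e. N e \<and> R e}"
  using assms by auto

lemma inner_vec2: "x \<bullet> y = x $ 1 * y $ 1 + x $ 2 * y $ 2" for x y :: "real^2"
  by (simp add: inner_vec_def sum_2)

lemma norm_eq_1_vec2: "norm e = 1 \<longleftrightarrow> (e $ 1)\<^sup>2 + (e $ 2)\<^sup>2 = 1" for e :: "real^2"
  by (simp add: norm_eq_1 inner_vec2 power2_eq_square)

lemma laplacian_diagonal_quadratic:
  fixes a c :: real and x :: "real^2"
  shows "laplacian (\<lambda>x. a * (x $ 1)\<^sup>2 + c * (x $ 2)\<^sup>2) x = 2 * (a + c)"
proof -
  have Basis: "(Basis :: (real^2) set) = {axis 1 1, axis 2 1}"
    by (auto simp: Basis_vec_def UNIV_2)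
  have neq: "axis 1 1 \<noteq> (axis 2 1 :: real^2)"
    by (simp add: axis_eq_axis)
  have second: "deriv (deriv (\<lambda>t. a * ((x + t *\<^sub>R b) $ 1)\<^sup>2 + c * ((x + t *\<^sub>R b) $ 2)\<^sup>2)) 0
      = 2 * a * (b $ 1)\<^sup>2 + 2 * c * (b $ 2)\<^sup>2" for b :: "real^2"
  proof -
    have first: "deriv (\<lambda>t. a * ((x + t *\<^sub>R b) $ 1)\<^sup>2 + c * ((x + t *\<^sub>R b) $ 2)\<^sup>2)
        = (\<lambda>t. 2 * a * (x $ 1 + t * b $ 1) * b $ 1 + 2 * c * (x $ 2 + t * b $ 2) * b $ 2)"
      by (rule ext, rule DERIV_imp_deriv) (auto intro!: derivative_eq_intros)
    show ?thesis
      unfolding first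
      by (rule DERIV_imp_deriv) (auto intro!: derivative_eq_intros simp: power2_eq_square)
  qed
  show ?thesis
    unfolding laplacian_def second Basis using neq by (simp add: axis_def)
qed

lemma halfspace_bump_le_quadratic_iff:
  fixes A C l :: real and e :: "real^2"
  assumes "A > 0" "C > 0" "l > 0" "norm e = 1"
  shows "(\<forall>x. l * (max 0 (x \<bullet> e))\<^sup>2 \<le> A * (x $ 1)\<^sup>2 + C * (x $ 2)\<^sup>2) \<longleftrightarrow>
    0 \<le> (A - l) * C * (e $ 1)\<^sup>2 + (C - l) * A * (e $ 2)\<^sup>2"
proof -
  \<comment> \<open>\<open>q\<close> is \<open>A * C\<close> times the dual form
    \<open>e\<^sub>1\<^sup>2 / A + e\<^sub>2\<^sup>2 / C\<close>, so the criterion can be stated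
    without division.\<close>
  define q where "q = C * (e $ 1)\<^sup>2 + A * (e $ 2)\<^sup>2"
  have unit: "(e $ 1)\<^sup>2 + (e $ 2)\<^sup>2 = 1"
    using assms(4) by (simp add: norm_eq_1_vec2)
  have "q > 0"
  proof (cases "e $ 1 = 0")
    case True
    then show ?thesis using unit assms by (simp add: q_def)
  next
    case False
    then show ?thesis using assms by (simp add: q_def add_pos_nonneg)
  qed
  have "(A - l) * C * (e $ 1)\<^sup>2 + (C - l) * A * (e $ 2)\<^sup>2
      = A * C * ((e $ 1)\<^sup>2 + (e $ 2)\<^sup>2) - l * q"
    unfolding q_def by algebra
  then have rhs: "0 \<le> (A - l) * C * (e $ 1)\<^sup>2 + (C - l) * A * (e $ 2)\<^sup>2 \<longleftrightarrow> l * q \<le> A * C"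
    using unit by simp
  show ?thesis
    unfolding rhs
  proof
    assume *: "\<forall>x. l * (max 0 (x \<bullet> e))\<^sup>2 \<le> A * (x $ 1)\<^sup>2 + C * (x $ 2)\<^sup>2"
    \<comment> \<open>the equality case of Cauchy--Schwarz\<close>
    define y :: "real^2" where "y = vector [C * e $ 1, A * e $ 2]"
    have "y \<bullet> e = q"
      by (simp add: y_def q_def inner_vec2 power2_eq_square)
    then have "l * q\<^sup>2 \<le> A * (C * e $ 1)\<^sup>2 + C * (A * e $ 2)\<^sup>2"
      using *[rule_format, of y] \<open>q > 0\<close> by (simp add: y_def)
    also have "\<dots> = A * C * q"
      unfolding q_def by algebra
    finally have "(l * q) * q \<le> (A * C) * q"
      by (simp add: power2_eq_square)
    then show "l * q \<le> A * C"
      using \<open>q > 0\<close> by simp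
  next
    assume *: "l * q \<le> A * C"
    show "\<forall>x. l * (max 0 (x \<bullet> e))\<^sup>2 \<le> A * (x $ 1)\<^sup>2 + C * (x $ 2)\<^sup>2"
    proof
      fix x :: "real^2"
      define Q where "Q = A * (x $ 1)\<^sup>2 + C * (x $ 2)\<^sup>2"
      have "Q \<ge> 0"
        using assms by (simp add: Q_def)
      \<comment> \<open>A weighted Lagrange identity: the defect in the Cauchy-Schwarz inequality is
        a square.\<close>
      have "Q * q - (A * C) * (x \<bullet> e)\<^sup>2 = (A * x $ 1 * e $ 2 - C * x $ 2 * e $ 1)\<^sup>2"
        unfolding Q_def q_def inner_vec2 by algebra
      then have "(A * C) * (x \<bullet> e)\<^sup>2 \<le> Q * q"
        by (metis diff_ge_0_iff_ge zero_le_power2)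
      then have "l * ((A * C) * (x \<bullet> e)\<^sup>2) \<le> l * (Q * q)"
        using assms by simp
      also have "\<dots> \<le> Q * (A * C)"
        using mult_left_mono[OF * \<open>Q \<ge> 0\<close>] by (simp add: mult_ac)
      finally have "(A * C) * (l * (x \<bullet> e)\<^sup>2) \<le> (A * C) * Q"
        by (simp add: mult_ac)
      then have "l * (x \<bullet> e)\<^sup>2 \<le> Q"
        using assms by simp
      moreover have "(max 0 (x \<bullet> e))\<^sup>2 \<le> (x \<bullet> e)\<^sup>2"
        by (simp add: max_def)
      ultimately have "l * (max 0 (x \<bullet> e))\<^sup>2 \<le> Q"
        using assms(3) by (meson mult_left_mono less_imp_le order_trans)
      then show "l * (max 0 (x \<bullet> e))\<^sup>2 \<le> A * (x $ 1)\<^sup>2 + C * (x $ 2)\<^sup>2"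
        by (simp add: Q_def)
    qed
  qed
qed

text \<open>The bump criterion applies with \<open>l = - (a1 + c1)\<close>, which is positive; then
  \<open>A - l = a2 + c1\<close> and \<open>C - l = a1 + c2\<close>.\<close>

lemma halfspace_solutions1_eq:
  fixes a1 a2 c1 c2 :: real
  assumes "a1 < a2" "c1 < c2" "a1 + c1 < 0"
    and p1: "p1 = (\<lambda>x. a1 * (x $ 1)\<^sup>2 + c1 * (x $ 2)\<^sup>2)"
    and p2: "p2 = (\<lambda>x. a2 * (x $ 1)\<^sup>2 + c2 * (x $ 2)\<^sup>2)"
  shows "halfspace_solutions1 p1 p2 = halfspace_perturbation p1 (- (a1 + c1)) `
    unit_directions ((a2 + c1) * (c2 - c1)) ((a1 + c2) * (a2 - a1))"
proof -
  have lap: "- (laplacian p1 x / 2) = - (a1 + c1)" for x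
    by (simp add: p1 laplacian_diagonal_quadratic field_simps)
  have iff: "(\<forall>x. halfspace_perturbation p1 (- (a1 + c1)) e x \<le> p2 x) \<longleftrightarrow>
      0 \<le> (a2 + c1) * (c2 - c1) * (e $ 1)\<^sup>2 + (a1 + c2) * (a2 - a1) * (e $ 2)\<^sup>2"
    if "norm e = 1" for e
    using halfspace_bump_le_quadratic_iff[of "a2 - a1" "c2 - c1" "- (a1 + c1)" e] that assms
    by (simp add: halfspace_perturbation_def algebra_simps)
  have eq: "(\<forall>x. u x - p1 x = - (a1 + c1) * (max 0 (x \<bullet> e))\<^sup>2) \<longleftrightarrow>
      u = halfspace_perturbation p1 (- (a1 + c1)) e" for u e
    by (auto simp: halfspace_perturbation_def fun_eq_iff algebra_simps)
  show ?thesis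
    unfolding halfspace_solutions1_def lap eq unit_directions_def
    by (rule Collect_parametrized_eq_image) (rule iff)
qed

text \<open>Subtracting a bump from \<open>p2\<close> and staying above \<open>p1\<close> is the
  same inequality, now with \<open>l = a2 + c2\<close>. Hence \<open>A - l = - (a1 + c2)\<close> and
  \<open>C - l = - (a2 + c1)\<close>: the two numbers trade places and change sign.\<close>

lemma halfspace_solutions2_eq:
  fixes a1 a2 c1 c2 :: real
  assumes "a1 < a2" "c1 < c2" "a2 + c2 > 0"
    and p1: "p1 = (\<lambda>x. a1 * (x $ 1)\<^sup>2 + c1 * (x $ 2)\<^sup>2)"
    and p2: "p2 = (\<lambda>x. a2 * (x $ 1)\<^sup>2 + c2 * (x $ 2)\<^sup>2)"
  shows "halfspace_solutions2 p1 p2 = halfspace_perturbation p2 (- (a2 + c2)) `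
    unit_directions (- (a1 + c2) * (c2 - c1)) (- (a2 + c1) * (a2 - a1))"
proof -
  have lap: "laplacian p2 x / 2 = a2 + c2" for x
    by (simp add: p2 laplacian_diagonal_quadratic)
  have iff: "(\<forall>x. p1 x \<le> halfspace_perturbation p2 (- (a2 + c2)) e x) \<longleftrightarrow>
      0 \<le> - (a1 + c2) * (c2 - c1) * (e $ 1)\<^sup>2 + - (a2 + c1) * (a2 - a1) * (e $ 2)\<^sup>2"
    if "norm e = 1" for e
    using halfspace_bump_le_quadratic_iff[of "a2 - a1" "c2 - c1" "a2 + c2" e] that assms
    by (simp add: halfspace_perturbation_def algebra_simps)
  have eq: "(\<forall>x. p2 x - u x = (a2 + c2) * (max 0 (x \<bullet> e))\<^sup>2) \<longleftrightarrow>
      u = halfspace_perturbation p2 (- (a2 + c2)) e" for u e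
    by (auto simp: halfspace_perturbation_def fun_eq_iff algebra_simps)
  show ?thesis
    unfolding halfspace_solutions2_def lap eq unit_directions_def
    by (rule Collect_parametrized_eq_image) (rule iff)
qed

section \<open>From directions to solutions and free boundaries\<close>

lemma inj_halfspace_perturbation:
  assumes "k \<noteq> 0"
  shows "inj (halfspace_perturbation p k)"
proof (rule injI)
  fix e e' assume "halfspace_perturbation p k e = halfspace_perturbation p k e'"
  then have "(max 0 (x \<bullet> e))\<^sup>2 = (max 0 (x \<bullet> e'))\<^sup>2" for x
    using assms by (auto simp: halfspace_perturbation_def fun_eq_iff)
  then have pos: "max 0 (x \<bullet> e) = max 0 (x \<bullet> e')" for x
    by (simp add: power2_eq_iff_nonneg)
  \<comment> \<open>The positive parts at \<open>x\<close> and at \<open>- x\<close> together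
    recover the inner product. In particular \<open>e\<close> and \<open>- e\<close> give different
    solutions, although their free boundaries coincide.\<close>
  have "x \<bullet> e = x \<bullet> e'" for x
    using pos[of x] pos[of "- x"] by (simp add: max_def split: if_splits)
  then show "e = e'"
    by (metis vector_eq_ldot)
qed

lemma free_boundary_halfspace_perturbation:
  assumes "k \<noteq> 0" "e \<noteq> 0"
  shows "free_boundary p (halfspace_perturbation p k e) = {x. x \<bullet> e = 0}"
proof -
  have "{x. halfspace_perturbation p k e x \<noteq> p x} = {x. e \<bullet> x > 0}"
    using assms by (auto simp: halfspace_perturbation_def inner_commute max_def)
  then show ?thesis
    using frontier_halfspace_gt[of e 0] assms(2) by (simp add: free_boundary_def inner_commute)
qed

text \<open>With nonnegative coefficients every unit vector is admissible, and every line through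
  the origin is the orthogonal complement of a unit vector.\<close>

lemma rotationally_invariant_all_directions:
  assumes "k \<noteq> 0" "m \<ge> 0" "n \<ge> 0"
  shows "rotationally_invariant p (halfspace_perturbation p k ` unit_directions m n)"
  unfolding rotationally_invariant_def
proof (intro allI impI, elim conjE)
  fix L :: "(real^2) set" assume L: "subspace L" "dim L = 1"
  then obtain a where a: "a \<noteq> 0" "span L \<subseteq> {x. a \<bullet> x = 0}"
    using lowdim_subset_hyperplane[of L] by auto
  define e where "e = sgn a"
  have e: "norm e = 1" "e \<noteq> 0"
    using a by (simp_all add: e_def norm_sgn sgn_zero_iff)
  have "L \<subseteq> {x. e \<bullet> x = 0}"
    using a(2) span_superset[of L] by (auto simp: e_def sgn_div_norm)
  moreover have "dim {x. e \<bullet> x = 0} = 1"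
    using dim_hyperplane[OF e(2)] by simp
  \<comment> \<open>Both sides are one-dimensional subspaces, so the inclusion is an
    equality.\<close>
  ultimately have "L = {x. e \<bullet> x = 0}"
    using L by (intro subspace_dim_equal) (simp_all add: subspace_hyperplane)
  moreover have "e \<in> unit_directions m n"
    using e assms by (simp add: unit_directions_def)
  ultimately show "\<exists>u\<in>halfspace_perturbation p k ` unit_directions m n. free_boundary p u = L"
    using free_boundary_halfspace_perturbation[OF assms(1) e(2)] by (auto simp: inner_commute)
qed

section \<open>Counting solutions and confining their free boundaries\<close>

lemma infinite_unit_directions:
  assumes "m > 0 \<or> n > 0 \<or> (m \<ge> 0 \<and> n \<ge> 0)"
  shows "infinite (unit_directions m n)"
proof -
  \<comment> \<open>The form is homogeneous, so its sign survives normalization. It is enough to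
    find a curve of nonzero vectors with pairwise different directions on which the form is
    nonnegative.\<close>
  have dir: "infinite (unit_directions m n)"
    if "\<delta> > 0" and v: "\<And>s. s \<in> {0<..<\<delta>} \<Longrightarrow> 0 \<le> m * (v s $ 1)\<^sup>2 + n * (v s $ 2)\<^sup>2"
      and nz: "\<And>s. v s \<noteq> 0" and inj: "inj_on (\<lambda>s. sgn (v s)) {0<..<\<delta>}"
    for \<delta> :: real and v :: "real \<Rightarrow> real^2"
  proof -
    have "sgn (v s) \<in> unit_directions m n" if "s \<in> {0<..<\<delta>}" for s
    proof -
      have "m * (sgn (v s) $ 1)\<^sup>2 + n * (sgn (v s) $ 2)\<^sup>2
          = (m * (v s $ 1)\<^sup>2 + n * (v s $ 2)\<^sup>2) / (norm (v s))\<^sup>2"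
        by (simp add: sgn_div_norm power_divide add_divide_distrib inverse_eq_divide)
      then show ?thesis
        using v[OF that] nz[of s] by (simp add: unit_directions_def norm_sgn)
    qed
    then have "(\<lambda>s. sgn (v s)) ` {0<..<\<delta>} \<subseteq> unit_directions m n"
      by blast
    moreover have "infinite ((\<lambda>s. sgn (v s)) ` {0<..<\<delta>})"
      using that(1) by (simp add: finite_image_iff[OF inj] infinite_Ioo)
    ultimately show ?thesis
      using finite_subset by blast
  qed
  have small: "\<exists>\<delta>>0. \<forall>s\<in>{0<..<\<delta>}. 0 \<le> a + b * s\<^sup>2" if "a > 0 \<or> a \<ge> 0 \<and> b \<ge> 0" for a b :: real
  proof (cases "b \<ge> 0")
    case True
    then show ?thesis using that by (intro exI[of _ 1]) auto
  next
    case False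
    then have ab: "a > 0" "b < 0" using that by auto
    \<comment> \<open>For \<open>b < 0\<close> the expression stays nonnegative up to its positive
      root \<open>sqrt (a / - b)\<close>.\<close>
    have "0 \<le> a + b * s\<^sup>2" if s: "s \<in> {0<..<sqrt (a / - b)}" for s
    proof -
      have "s\<^sup>2 \<le> (sqrt (a / - b))\<^sup>2"
        using s by (intro power_mono) auto
      then show ?thesis using ab by (simp add: field_simps)
    qed
    moreover have "sqrt (a / - b) > 0" using ab by (simp add: divide_pos_neg)
    ultimately show ?thesis by blast
  qed
  \<comment> \<open>Vectors with the same normalization are proportional; for two points of the
    curves used below, the vanishing determinant says that their parameters agree.\<close>
  have sgnD: "(v::real^2) $ 1 * w $ 2 = v $ 2 * w $ 1" if "sgn v = sgn w" "v \<noteq> 0" "w \<noteq> 0" for v w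
  proof -
    have "v = norm v *\<^sub>R sgn v"
      using that(2) by (simp add: sgn_div_norm)
    also have "\<dots> = (norm v * inverse (norm w)) *\<^sub>R w"
      unfolding that(1) by (simp add: sgn_div_norm)
    finally obtain c where "v = c *\<^sub>R w" by blast
    then show ?thesis by simp
  qed
  \<comment> \<open>The signs decide which coordinate axis to perturb: the curve is
    \<open>vector [1, s]\<close> in the first case and \<open>vector [s, 1]\<close> in the second,
    for small positive \<open>s\<close>. If both coefficients are nonnegative, either choice
    works.\<close>
  consider "m > 0 \<or> m \<ge> 0 \<and> n \<ge> 0" | "n > 0 \<or> n \<ge> 0 \<and> m \<ge> 0"
    using assms by blast
  then show ?thesis
  proof cases
    case 1
    from small[OF 1] obtain \<delta> where "\<delta> > 0" "\<forall>s\<in>{0<..<\<delta>}. 0 \<le> m + n * s\<^sup>2" by blast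
    moreover have nz: "vector [1, s] \<noteq> (0::real^2)" for s
      by (metis vector_2(1) zero_index zero_neq_one)
    moreover have "inj_on (\<lambda>s. sgn (vector [1, s] :: real^2)) {0<..<\<delta>}"
      using sgnD[OF _ nz nz] by (auto intro!: inj_onI)
    ultimately show ?thesis
      using dir[of \<delta> "\<lambda>s. vector [1, s]"] by simp
  next
    case 2
    from small[OF 2] obtain \<delta> where "\<delta> > 0" "\<forall>s\<in>{0<..<\<delta>}. 0 \<le> n + m * s\<^sup>2" by blast
    moreover have nz: "vector [s, 1] \<noteq> (0::real^2)" for s
      by (metis vector_2(2) zero_index zero_neq_one)
    moreover have "inj_on (\<lambda>s. sgn (vector [s, 1] :: real^2)) {0<..<\<delta>}"
      using sgnD[OF _ nz nz] by (auto intro!: inj_onI)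
    ultimately show ?thesis
      using dir[of \<delta> "\<lambda>s. vector [s, 1]"] by (simp add: add.commute)
  qed
qed

lemma infinite_halfspace_perturbations:
  assumes "k \<noteq> 0" "m > 0 \<or> n > 0 \<or> (m \<ge> 0 \<and> n \<ge> 0)"
  shows "infinite (halfspace_perturbation p k ` unit_directions m n)"
  using infinite_unit_directions[OF assms(2)] inj_halfspace_perturbation[OF assms(1)]
  by (meson finite_imageD inj_on_subset subset_UNIV)

lemma confined_to_cone_halfspace_perturbations:
  assumes "k \<noteq> 0" "m < 0 \<or> n < 0"
  shows "confined_to_cone p (halfspace_perturbation p k ` unit_directions m n)"
  unfolding confined_to_cone_def
proof (intro exI conjI ballI)
  \<comment> \<open>The admissible directions, rotated by a right angle.\<close>
  define K :: "(real^2) set" where "K = {x. 0 \<le> m * (x $ 2)\<^sup>2 + n * (x $ 1)\<^sup>2}"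
  have "m * (c * s)\<^sup>2 + n * (c * t)\<^sup>2 = c\<^sup>2 * (m * s\<^sup>2 + n * t\<^sup>2)" for c s t :: real
    by algebra
  then show "cone K"
    by (simp add: cone_def K_def)
  show "closed K"
    unfolding K_def by (intro closed_Collect_le continuous_intros)
  \<comment> \<open>On these two axis vectors the form defining \<open>K\<close> takes the values
    \<open>m\<close> and \<open>n\<close>, one of which is negative.\<close>
  have "vector [0, 1] \<notin> K \<or> vector [1, 0] \<notin> K"
    using assms(2) by (auto simp: K_def)
  then show "K \<noteq> UNIV"
    by blast
  fix u assume "u \<in> halfspace_perturbation p k ` unit_directions m n"
  then obtain e where e: "norm e = 1" "0 \<le> m * (e $ 1)\<^sup>2 + n * (e $ 2)\<^sup>2"
    and u: "u = halfspace_perturbation p k e"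
    by (auto simp: unit_directions_def)
  have "x \<in> K" if "x \<bullet> e = 0" for x
  proof -
    \<comment> \<open>\<open>t\<close> is the coordinate of \<open>x\<close> along the unit vector
      with entries \<open>- e $ 2\<close> and \<open>e $ 1\<close>, which spans the line orthogonal
      to \<open>e\<close>.\<close>
    define t where "t = x $ 2 * e $ 1 - x $ 1 * e $ 2"
    have "x $ 1 * e $ 1 + x $ 2 * e $ 2 = 0" "(e $ 1)\<^sup>2 + (e $ 2)\<^sup>2 = 1"
      using that e by (simp_all add: inner_vec2 norm_eq_1_vec2)
    then have "x $ 1 = - t * e $ 2" "x $ 2 = t * e $ 1"
      unfolding t_def by algebra+
    then have "m * (x $ 2)\<^sup>2 + n * (x $ 1)\<^sup>2 = t\<^sup>2 * (m * (e $ 1)\<^sup>2 + n * (e $ 2)\<^sup>2)"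
      by (simp add: power_mult_distrib algebra_simps)
    then show ?thesis
      using e by (simp add: K_def)
  qed
  moreover have "e \<noteq> 0"
    using e by auto
  ultimately show "free_boundary p u \<subseteq> K"
    using free_boundary_halfspace_perturbation[OF assms(1)] u by blast
qed

text \<open>A line through the origin and a point outside the cone cannot be a free
  boundary.\<close>

lemma confined_to_cone_imp_not_rotationally_invariant:
  assumes "confined_to_cone p S"
  shows "\<not> rotationally_invariant p S"
proof
  assume rot: "rotationally_invariant p S"
  obtain K where K: "K \<noteq> UNIV" "\<forall>u\<in>S. free_boundary p u \<subseteq> K"
    using assms by (auto simp: confined_to_cone_def)
  obtain x where "x \<notin> K"
    using K by blast
  \<comment> \<open>The point \<open>x\<close> itself serves unless it is zero; then any nonzero
    vector does, such as an axis vector.\<close>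
  obtain y :: "real^2" where "y \<noteq> 0" "x \<in> span {y}"
    by (metis axis_eq_0_iff span_base span_zero singletonI zero_neq_one)
  then have "subspace (span {y})" "dim (span {y}) = 1" "x \<in> span {y}"
    by (simp_all add: dim_insert)
  then show False
    using rot K \<open>x \<notin> K\<close> unfolding rotationally_invariant_def by blast
qed

text \<open>Both terms of the form are nonpositive, so a nonnegative sum makes each vanish. The
  strictly negative coefficient then kills one coordinate, and unit length leaves only two opposite
  axis vectors.\<close>

lemma card_halfspace_perturbations_le_2:
  assumes "m \<le> 0 \<and> n < 0 \<or> m < 0 \<and> n \<le> 0"
  shows "finite (halfspace_perturbation p k ` unit_directions m n) \<and>
    card (halfspace_perturbation p k ` unit_directions m n) \<le> 2"
proof -
  have "\<exists>a. unit_directions m n \<subseteq> {a, - a}"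
    using assms
  proof
    assume mn: "m \<le> 0 \<and> n < 0"
    have "e \<in> {axis 1 1, - axis 1 1}" if "e \<in> unit_directions m n" for e
    proof -
      have e: "(e $ 1)\<^sup>2 + (e $ 2)\<^sup>2 = 1" "0 \<le> m * (e $ 1)\<^sup>2 + n * (e $ 2)\<^sup>2"
        using that by (simp_all add: unit_directions_def norm_eq_1_vec2)
      have "m * (e $ 1)\<^sup>2 \<le> 0"
        using mn by (simp add: mult_nonpos_nonneg)
      then have "0 \<le> n * (e $ 2)\<^sup>2"
        using e by linarith
      then have "e $ 2 = 0"
        using mn by (simp add: zero_le_mult_iff)
      then show ?thesis
        using e by (auto simp: vec_eq_iff forall_2 axis_def power2_eq_1_iff)
    qed
    then show ?thesis by blast
  next
    assume mn: "m < 0 \<and> n \<le> 0"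
    have "e \<in> {axis 2 1, - axis 2 1}" if "e \<in> unit_directions m n" for e
    proof -
      have e: "(e $ 1)\<^sup>2 + (e $ 2)\<^sup>2 = 1" "0 \<le> m * (e $ 1)\<^sup>2 + n * (e $ 2)\<^sup>2"
        using that by (simp_all add: unit_directions_def norm_eq_1_vec2)
      have "n * (e $ 2)\<^sup>2 \<le> 0"
        using mn by (simp add: mult_nonpos_nonneg)
      then have "0 \<le> m * (e $ 1)\<^sup>2"
        using e by linarith
      then have "e $ 1 = 0"
        using mn by (simp add: zero_le_mult_iff)
      then show ?thesis
        using e by (auto simp: vec_eq_iff forall_2 axis_def power2_eq_1_iff)
    qed
    then show ?thesis by blast
  qed
  then obtain a where a: "unit_directions m n \<subseteq> {a, - a}" ..
  then have "finite (unit_directions m n)" "card (unit_directions m n) \<le> card {a, - a}"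
    by (auto intro: finite_subset card_mono)
  moreover have "card {a, - a} \<le> 2"
    by (simp add: card_insert_if)
  ultimately show ?thesis
    using card_image_le[of "unit_directions m n" "halfspace_perturbation p k"] by simp
qed

section \<open>The sign patterns of the three cases\<close>

theorem theorem3p11:
  fixes a1 a2 c1 c2 :: real and p1 p2 :: "real^2 \<Rightarrow> real"
  assumes "a1 < a2" and "c1 < c2" and "a1 + c1 < 0" and "a2 + c2 > 0"
    and "p1 = (\<lambda>x. a1 * (x $ 1)\<^sup>2 + c1 * (x $ 2)\<^sup>2)"
    and "p2 = (\<lambda>x. a2 * (x $ 1)\<^sup>2 + c2 * (x $ 2)\<^sup>2)"
  shows
    "(a2 + c1 = 0 \<and> c2 + a1 = 0 \<longrightarrow>
        infinite (halfspace_solutions1 p1 p2) \<and>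
        rotationally_invariant p1 (halfspace_solutions1 p1 p2) \<and>
        infinite (halfspace_solutions2 p1 p2) \<and>
        rotationally_invariant p2 (halfspace_solutions2 p1 p2)) \<and>
     ((a1 + c2) * (c1 + a2) < 0 \<longrightarrow>
        infinite (halfspace_solutions1 p1 p2) \<and>
        confined_to_cone p1 (halfspace_solutions1 p1 p2) \<and>
        \<not> rotationally_invariant p1 (halfspace_solutions1 p1 p2) \<and>
        infinite (halfspace_solutions2 p1 p2) \<and>
        confined_to_cone p2 (halfspace_solutions2 p1 p2) \<and>
        \<not> rotationally_invariant p2 (halfspace_solutions2 p1 p2)) \<and>
     ((a1 + c2) * (c1 + a2) \<ge> 0 \<and> (a1 + c2 \<noteq> 0 \<or> a2 + c1 \<noteq> 0) \<longrightarrow>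
        (a1 + c2 \<ge> 0 \<and> a2 + c1 > 0 \<longrightarrow>
           infinite (halfspace_solutions1 p1 p2) \<and>
           rotationally_invariant p1 (halfspace_solutions1 p1 p2) \<and>
           finite (halfspace_solutions2 p1 p2) \<and> card (halfspace_solutions2 p1 p2) \<le> 2) \<and>
        (a1 + c2 \<le> 0 \<and> a2 + c1 < 0 \<longrightarrow>
           infinite (halfspace_solutions2 p1 p2) \<and>
           rotationally_invariant p2 (halfspace_solutions2 p1 p2) \<and>
           finite (halfspace_solutions1 p1 p2) \<and> card (halfspace_solutions1 p1 p2) \<le> 2))"
proof -
  \<comment> \<open>The factors \<open>A\<close> and \<open>C\<close> are positive, so the signs of
    \<open>\<alpha>\<close> and \<open>\<beta>\<close> alone determine those of the coefficients in
    both direction sets.\<close>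
  define \<alpha> \<beta> where "\<alpha> = a2 + c1" and "\<beta> = a1 + c2"
  define A C where "A = a2 - a1" and "C = c2 - c1"
  have pos: "A > 0" "C > 0" and k: "- (a1 + c1) \<noteq> 0" "- (a2 + c2) \<noteq> 0"
    using assms(1-4) by (auto simp: A_def C_def)
  have S1: "halfspace_solutions1 p1 p2 =
      halfspace_perturbation p1 (- (a1 + c1)) ` unit_directions (\<alpha> * C) (\<beta> * A)"
    unfolding \<alpha>_def \<beta>_def A_def C_def
    by (rule halfspace_solutions1_eq) (use assms in auto)
  have S2: "halfspace_solutions2 p1 p2 =
      halfspace_perturbation p2 (- (a2 + c2)) ` unit_directions (- \<beta> * C) (- \<alpha> * A)"
    unfolding \<alpha>_def \<beta>_def A_def C_def
    by (rule halfspace_solutions2_eq) (use assms in auto)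
  have all1: "infinite (halfspace_solutions1 p1 p2)"
      "rotationally_invariant p1 (halfspace_solutions1 p1 p2)" if "\<alpha> \<ge> 0" "\<beta> \<ge> 0"
    unfolding S1 using that k pos
    by (simp_all add: infinite_halfspace_perturbations rotationally_invariant_all_directions)
  have all2: "infinite (halfspace_solutions2 p1 p2)"
      "rotationally_invariant p2 (halfspace_solutions2 p1 p2)" if "\<alpha> \<le> 0" "\<beta> \<le> 0"
    unfolding S2 using that k pos
    by (simp_all add: infinite_halfspace_perturbations rotationally_invariant_all_directions
        mult_nonpos_nonneg)
  have few1: "finite (halfspace_solutions1 p1 p2) \<and> card (halfspace_solutions1 p1 p2) \<le> 2"
    if "\<alpha> < 0" "\<beta> \<le> 0"
    unfolding S1 using that pos
    by (intro card_halfspace_perturbations_le_2) (simp add: mult_neg_pos mult_nonpos_nonneg)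
  have few2: "finite (halfspace_solutions2 p1 p2) \<and> card (halfspace_solutions2 p1 p2) \<le> 2"
    if "\<alpha> > 0" "\<beta> \<ge> 0"
    unfolding S2 using that pos
    by (intro card_halfspace_perturbations_le_2) simp
  have mixed1: "infinite (halfspace_solutions1 p1 p2)"
      "confined_to_cone p1 (halfspace_solutions1 p1 p2)" if "\<beta> * \<alpha> < 0"
  proof -
    from that have "\<alpha> < 0 \<and> \<beta> > 0 \<or> \<alpha> > 0 \<and> \<beta> < 0"
      by (auto simp: mult_less_0_iff)
    \<comment> \<open>The positive coefficient yields infinitely many directions, the negative one
      yields the cone.\<close>
    then have "\<alpha> * C > 0 \<or> \<beta> * A > 0" "\<alpha> * C < 0 \<or> \<beta> * A < 0"
      using pos by (auto simp: mult_less_0_iff zero_less_mult_iff)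
    then show "infinite (halfspace_solutions1 p1 p2)"
        "confined_to_cone p1 (halfspace_solutions1 p1 p2)"
      unfolding S1 using k(1)
      by (auto simp only: infinite_halfspace_perturbations
          confined_to_cone_halfspace_perturbations simp_thms)
  qed
  have mixed2: "infinite (halfspace_solutions2 p1 p2)"
      "confined_to_cone p2 (halfspace_solutions2 p1 p2)" if "\<beta> * \<alpha> < 0"
  proof -
    from that have "\<alpha> < 0 \<and> \<beta> > 0 \<or> \<alpha> > 0 \<and> \<beta> < 0"
      by (auto simp: mult_less_0_iff)
    then have "- \<beta> * C > 0 \<or> - \<alpha> * A > 0" "- \<beta> * C < 0 \<or> - \<alpha> * A < 0"
      using pos by (auto simp: mult_less_0_iff zero_less_mult_iff)
    then show "infinite (halfspace_solutions2 p1 p2)"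
        "confined_to_cone p2 (halfspace_solutions2 p1 p2)"
      unfolding S2 using k(2)
      by (auto simp only: infinite_halfspace_perturbations
          confined_to_cone_halfspace_perturbations simp_thms)
  qed
  \<comment> \<open>The statement writes each sum in both orders, so both are folded.\<close>
  have \<alpha>\<beta>: "a2 + c1 = \<alpha>" "c1 + a2 = \<alpha>" "a1 + c2 = \<beta>" "c2 + a1 = \<beta>"
    by (simp_all add: \<alpha>_def \<beta>_def)
  show ?thesis
    unfolding \<alpha>\<beta>
    by (intro conjI impI)
      (simp_all add: all1 all2 few1 few2 mixed1 mixed2
        confined_to_cone_imp_not_rotationally_invariant)
qed

end
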